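(* Let $T$ be a rooted, countably infinite and locally finite tree and let $S$ be the forward shift. Then $S$ maps $\mathcal{L}$ into $\mathcal{L}$, $S:\mathcal{L}\to\mathcal{L}$ is bounded, and $\|S\|\le 1$. If $T$ is leafless, then $\|Sf\|=\|f\|$ for every $f\in\mathcal{L}$.
   Context: A tree is an undirected graph (no loops or multiple edges) in which any two vertices are joined by exactly one path; $T$ also denotes its vertex set. It is locally finite if every vertex has finite degree. $T$ has a distinguished vertex $o$, the root. For $v\neq o$, the parent $\mathrm{par}(v)$ is the vertex preceding $v$ on the unique path from $o$ to $v$; the vertices with parent $v$ are the children of $v$. A leaf is a vertex with no children; $T$ is leafless if it has no leaves. For $f:T\to\mathbb{C}$ define $f':T\to\mathbb{C}$ by $f'(o)=f(o)$ and $f'(v)=f(v)-f(\mathrm{par}(v))$ for $v\neq o$. The Lipschitz space $\mathcal{L}$ is the Banach space of all $f:T\to\mathbb{C}$ with $f'$ bounded, with norm $\|f\|=\sup_{v\in T}|f'(v)|$. The forward shift is defined on functions $f:T\to\mathbb{C}$ by $(Sf)(o)=0$ and $(Sf)(v)=f(\mathrm{par}(v))$ for $v\ne o$. *)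

theory Defs
  imports "HOL-Analysis.Analysis"
begin

text \<open>
  The vertex set of the tree is the whole type \<open>'v\<close>, so that functions on the tree are exactly
  the functions \<open>'v \<Rightarrow> complex\<close>. A graph is given by its adjacency relation \<open>E\<close>; the root is \<open>r\<close>.
\<close>

definition simple_graph :: "('v \<Rightarrow> 'v \<Rightarrow> bool) \<Rightarrow> bool" where
  "simple_graph E \<longleftrightarrow> symp E \<and> irreflp E"

definition vertex_path :: "('v \<Rightarrow> 'v \<Rightarrow> bool) \<Rightarrow> 'v \<Rightarrow> 'v \<Rightarrow> 'v list \<Rightarrow> bool" where
  "vertex_path E u v p \<longleftrightarrow>
     p \<noteq> [] \<and> hd p = u \<and> last p = v \<and> distinct p \<and> successively E p"

definition tree :: "('v \<Rightarrow> 'v \<Rightarrow> bool) \<Rightarrow> bool" where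
  "tree E \<longleftrightarrow> simple_graph E \<and> (\<forall>u v. \<exists>!p. vertex_path E u v p)"

definition locally_finite_graph :: "('v \<Rightarrow> 'v \<Rightarrow> bool) \<Rightarrow> bool" where
  "locally_finite_graph E \<longleftrightarrow> (\<forall>v. finite {w. E v w})"

definition tree_path :: "('v \<Rightarrow> 'v \<Rightarrow> bool) \<Rightarrow> 'v \<Rightarrow> 'v \<Rightarrow> 'v list" where
  "tree_path E u v = (THE p. vertex_path E u v p)"

text \<open>Only meaningful for \<open>v \<noteq> r\<close>; the path from the root to such a \<open>v\<close> has at least two vertices.\<close>

definition parent :: "('v \<Rightarrow> 'v \<Rightarrow> bool) \<Rightarrow> 'v \<Rightarrow> 'v \<Rightarrow> 'v" where
  "parent E r v = last (butlast (tree_path E r v))"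

definition children :: "('v \<Rightarrow> 'v \<Rightarrow> bool) \<Rightarrow> 'v \<Rightarrow> 'v \<Rightarrow> 'v set" where
  "children E r v = {w. w \<noteq> r \<and> parent E r w = v}"

definition leaf :: "('v \<Rightarrow> 'v \<Rightarrow> bool) \<Rightarrow> 'v \<Rightarrow> 'v \<Rightarrow> bool" where
  "leaf E r v \<longleftrightarrow> children E r v = {}"

definition leafless :: "('v \<Rightarrow> 'v \<Rightarrow> bool) \<Rightarrow> 'v \<Rightarrow> bool" where
  "leafless E r \<longleftrightarrow> (\<nexists>v. leaf E r v)"

definition tree_deriv ::
  "('v \<Rightarrow> 'v \<Rightarrow> bool) \<Rightarrow> 'v \<Rightarrow> ('v \<Rightarrow> complex) \<Rightarrow> 'v \<Rightarrow> complex" where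
  "tree_deriv E r f v = (if v = r then f r else f v - f (parent E r v))"

definition lipschitz_space :: "('v \<Rightarrow> 'v \<Rightarrow> bool) \<Rightarrow> 'v \<Rightarrow> ('v \<Rightarrow> complex) set" where
  "lipschitz_space E r = {f. bounded (range (tree_deriv E r f))}"

text \<open>A real supremum, hence only meaningful for \<open>f \<in> lipschitz_space E r\<close>.\<close>

definition lip_norm :: "('v \<Rightarrow> 'v \<Rightarrow> bool) \<Rightarrow> 'v \<Rightarrow> ('v \<Rightarrow> complex) \<Rightarrow> real" where
  "lip_norm E r f = (SUP v. cmod (tree_deriv E r f v))"

definition forward_shift ::
  "('v \<Rightarrow> 'v \<Rightarrow> bool) \<Rightarrow> 'v \<Rightarrow> ('v \<Rightarrow> complex) \<Rightarrow> 'v \<Rightarrow> complex" where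
  "forward_shift E r f v = (if v = r then 0 else f (parent E r v))"

text \<open>
  The Lipschitz space depends on the term \<open>E\<close>, so it is a carrier set and not a type; this rules out
  \<^const>\<open>bounded_linear\<close> and \<^const>\<open>onorm\<close>. The following are their counterparts for
  complex-linear operators on the carrier.
\<close>

definition lip_bounded_operator ::
  "('v \<Rightarrow> 'v \<Rightarrow> bool) \<Rightarrow> 'v \<Rightarrow> (('v \<Rightarrow> complex) \<Rightarrow> ('v \<Rightarrow> complex)) \<Rightarrow> bool" where
  "lip_bounded_operator E r A \<longleftrightarrow>
     A \<in> lipschitz_space E r \<rightarrow> lipschitz_space E r \<and>
     (\<forall>f\<in>lipschitz_space E r. \<forall>g\<in>lipschitz_space E r.
        A (\<lambda>v. f v + g v) = (\<lambda>v. A f v + A g v)) \<and>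
     (\<forall>c. \<forall>f\<in>lipschitz_space E r. A (\<lambda>v. c * f v) = (\<lambda>v. c * A f v)) \<and>
     (\<exists>C. \<forall>f\<in>lipschitz_space E r. lip_norm E r (A f) \<le> C * lip_norm E r f)"

text \<open>Meaningful for bounded operators, for which the supremum is over a bounded set.\<close>

definition lip_operator_norm ::
  "('v \<Rightarrow> 'v \<Rightarrow> bool) \<Rightarrow> 'v \<Rightarrow> (('v \<Rightarrow> complex) \<Rightarrow> ('v \<Rightarrow> complex)) \<Rightarrow> real" where
  "lip_operator_norm E r A =
     (SUP f\<in>{f \<in> lipschitz_space E r. lip_norm E r f \<le> 1}. lip_norm E r (A f))"

end

theory Submission
  imports Defs
begin

text \<open>
  The shift intertwines the discrete derivative with itself: \<open>(Sf)'(o) = 0\<close>, and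
  \<open>(Sf)'(v) = f'(par v)\<close> for \<open>v \<noteq> o\<close> (lemma \<open>tree_deriv_forward_shift\<close>).
  For \<open>v\<close> at distance at least two from the root this is the telescoping
  \<open>Sf(v) - Sf(par v) = f(par v) - f(par (par v))\<close>. For a child of the root it holds because
  \<open>Sf(o) = 0\<close> and \<open>f'(o) = f(o)\<close>.

  Hence every value of \<open>(Sf)'\<close> is \<open>0\<close> or a value of \<open>f'\<close>, which makes \<open>S\<close> a contraction.
  If the tree is leafless, every vertex is the parent of some vertex, so every value of \<open>f'\<close> is
  also a value of \<open>(Sf)'\<close> and the two suprema agree.
\<close>

lemma tree_deriv_forward_shift:
  "tree_deriv E r (forward_shift E r f) v = (if v = r then 0 else tree_deriv E r f (parent E r v))"
  by (simp add: tree_deriv_def forward_shift_def)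

lemma bdd_above_tree_deriv:
  assumes "f \<in> lipschitz_space E r"
  shows "bdd_above (range (\<lambda>v. cmod (tree_deriv E r f v)))"
proof -
  from assms obtain B where "\<And>v. cmod (tree_deriv E r f v) \<le> B"
    unfolding lipschitz_space_def bounded_iff by auto
  then show ?thesis by (intro bdd_aboveI2)
qed

lemma cmod_tree_deriv_le_lip_norm:
  assumes "f \<in> lipschitz_space E r"
  shows "cmod (tree_deriv E r f v) \<le> lip_norm E r f"
  unfolding lip_norm_def by (rule cSUP_upper[OF UNIV_I bdd_above_tree_deriv[OF assms]])

lemma lip_norm_leI:
  assumes "\<And>v. cmod (tree_deriv E r f v) \<le> B"
  shows "lip_norm E r f \<le> B"
  unfolding lip_norm_def by (rule cSUP_least) (use assms in auto)

lemma cmod_tree_deriv_forward_shift_le: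
  assumes "f \<in> lipschitz_space E r"
  shows "cmod (tree_deriv E r (forward_shift E r f) v) \<le> lip_norm E r f"
proof -
  have "0 \<le> lip_norm E r f"
    using cmod_tree_deriv_le_lip_norm[OF assms] by (rule order_trans[OF norm_ge_zero])
  then show ?thesis
    using cmod_tree_deriv_le_lip_norm[OF assms] by (simp add: tree_deriv_forward_shift)
qed

lemma forward_shift_lipschitz_space:
  "forward_shift E r \<in> lipschitz_space E r \<rightarrow> lipschitz_space E r"
proof
  fix f assume "f \<in> lipschitz_space E r"
  from cmod_tree_deriv_forward_shift_le[OF this]
  show "forward_shift E r f \<in> lipschitz_space E r"
    unfolding lipschitz_space_def by (auto intro: boundedI)
qed

lemma lip_norm_forward_shift_le:
  assumes "f \<in> lipschitz_space E r"
  shows "lip_norm E r (forward_shift E r f) \<le> lip_norm E r f"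
  by (rule lip_norm_leI) (rule cmod_tree_deriv_forward_shift_le[OF assms])

lemma lip_bounded_operator_forward_shift:
  "lip_bounded_operator E r (forward_shift E r)"
  unfolding lip_bounded_operator_def
proof (intro conjI ballI allI)
  show "\<exists>C. \<forall>f\<in>lipschitz_space E r. lip_norm E r (forward_shift E r f) \<le> C * lip_norm E r f"
    using lip_norm_forward_shift_le[of _ E r] by (intro exI[of _ 1]) simp
qed (simp_all add: forward_shift_lipschitz_space forward_shift_def fun_eq_iff)

lemma lip_operator_norm_forward_shift_le:
  "lip_operator_norm E r (forward_shift E r) \<le> 1"
  unfolding lip_operator_norm_def
proof (rule cSUP_least)
  \<comment> \<open>A bound on a real supremum needs a nonempty index set; the zero function lies in the unit ball.\<close>
  have "tree_deriv E r (\<lambda>_. 0) = (\<lambda>_. 0)"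
    by (simp add: tree_deriv_def fun_eq_iff)
  then have "(\<lambda>_. 0) \<in> {f \<in> lipschitz_space E r. lip_norm E r f \<le> 1}"
    by (simp add: lipschitz_space_def lip_norm_def)
  then show "{f \<in> lipschitz_space E r. lip_norm E r f \<le> 1} \<noteq> {}"
    by blast
next
  fix f assume "f \<in> {f \<in> lipschitz_space E r. lip_norm E r f \<le> 1}"
  then show "lip_norm E r (forward_shift E r f) \<le> 1"
    using lip_norm_forward_shift_le[of f E r] by simp
qed

text \<open>
  A child \<open>w\<close> of \<open>v\<close> transports the value \<open>f'(v)\<close> to \<open>(Sf)'(w)\<close>, so no value of \<open>f'\<close> is lost
  when every vertex has a child.
\<close>

lemma lip_norm_forward_shift_leafless:
  assumes "leafless E r" and f: "f \<in> lipschitz_space E r"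
  shows "lip_norm E r (forward_shift E r f) = lip_norm E r f"
proof (rule antisym[OF lip_norm_forward_shift_le[OF f]], rule lip_norm_leI)
  fix v
  obtain w where "w \<noteq> r" "parent E r w = v"
    using \<open>leafless E r\<close> unfolding leafless_def leaf_def children_def by blast
  then have "tree_deriv E r f v = tree_deriv E r (forward_shift E r f) w"
    by (simp add: tree_deriv_forward_shift)
  moreover have "forward_shift E r f \<in> lipschitz_space E r"
    using forward_shift_lipschitz_space f by (rule funcset_mem)
  ultimately show "cmod (tree_deriv E r f v) \<le> lip_norm E r (forward_shift E r f)"
    by (simp add: cmod_tree_deriv_le_lip_norm)
qed

theorem theorem3p3:
  fixes E :: "'v \<Rightarrow> 'v \<Rightarrow> bool" and r :: 'v
  assumes "tree E"
    and "countable (UNIV :: 'v set)" and "infinite (UNIV :: 'v set)"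
    and "locally_finite_graph E"
  shows "forward_shift E r \<in> lipschitz_space E r \<rightarrow> lipschitz_space E r \<and>
         lip_bounded_operator E r (forward_shift E r) \<and>
         lip_operator_norm E r (forward_shift E r) \<le> 1 \<and>
         (leafless E r \<longrightarrow>
            (\<forall>f\<in>lipschitz_space E r. lip_norm E r (forward_shift E r f) = lip_norm E r f))"
  by (intro conjI impI ballI forward_shift_lipschitz_space lip_bounded_operator_forward_shift
      lip_operator_norm_forward_shift_le lip_norm_forward_shift_leafless)

end
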